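(* Let $k \ge 2$ and $n \ge k+1$ be integers. Then $$\operatorname{La}(n,Y_k,Y_k') = \Sigma(n,k).$$
   Context: $[n]=\{1,\dots,n\}$ and $2^{[n]}$ is its power set. $\Sigma(n,k)$ denotes the sum of the $k$ largest binomial coefficients of the form $\binom{n}{i}$, $0\le i\le n$. A family $\mathcal{A}\subset 2^{[n]}$ is viewed as a poset under inclusion. A poset $P$ is a (weak) subposet of a poset $Q$ if there is an injection $\phi:P\to Q$ such that $x\le y$ in $P$ implies $\phi(x)\le\phi(y)$ in $Q$. $\operatorname{La}(n,P,Q)$ is the size of the largest family $\mathcal{A}\subset 2^{[n]}$ containing neither $P$ nor $Q$ as a (weak) subposet. $Y_k$ is the poset on $k+2$ distinct elements $x_1,\dots,x_k,y,z$ whose order is generated by $x_1\le x_2\le\dots\le x_k$, $x_k\le y$ and $x_k\le z$. $Y_k'$ is the poset obtained from $Y_k$ by reversing all relations. *)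

theory Defs
  imports Complex_Main
begin

text \<open>A poset is given by its carrier together with its (reflexive) order relation on the carrier.\<close>

type_synonym 'a poset = "'a set \<times> 'a rel"

definition dual_poset :: "'a poset \<Rightarrow> 'a poset" where
  "dual_poset P = (fst P, (snd P)\<inverse>)"

definition inclusion_poset :: "'a set set \<Rightarrow> 'a set poset" where
  "inclusion_poset \<A> = (\<A>, {(A, B). A \<in> \<A> \<and> B \<in> \<A> \<and> A \<subseteq> B})"

definition weak_subposet :: "'a poset \<Rightarrow> 'b poset \<Rightarrow> bool" where
  "weak_subposet P Q \<longleftrightarrow>
     (\<exists>\<phi>. inj_on \<phi> (fst P) \<and> \<phi> ` fst P \<subseteq> fst Q \<and>
          (\<forall>x\<in>fst P. \<forall>y\<in>fst P. (x, y) \<in> snd P \<longrightarrow> (\<phi> x, \<phi> y) \<in> snd Q))"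

text \<open>The maximum is over a finite set, which is nonempty as soon as both posets have nonempty
  carriers (the empty family then qualifies).\<close>

definition La :: "nat \<Rightarrow> 'a poset \<Rightarrow> 'b poset \<Rightarrow> nat" where
  "La n P Q = Max {card \<A> | \<A>. \<A> \<subseteq> Pow {1..n} \<and>
     \<not> weak_subposet P (inclusion_poset \<A>) \<and> \<not> weak_subposet Q (inclusion_poset \<A>)}"

datatype Y_elem = X nat | Y | Z

definition Y_carrier :: "nat \<Rightarrow> Y_elem set" where
  "Y_carrier k = X ` {1..k} \<union> {Y, Z}"

definition Y_gen :: "nat \<Rightarrow> Y_elem rel" where
  "Y_gen k = {(X i, X (i + 1)) | i. 1 \<le> i \<and> i < k} \<union> {(X k, Y), (X k, Z)}"

text \<open>The closure operator adds the diagonal of the whole type, hence the restriction to the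
  carrier.\<close>

definition Y_poset :: "nat \<Rightarrow> Y_elem poset" where
  "Y_poset k = (Y_carrier k, (Y_gen k)\<^sup>* \<inter> Y_carrier k \<times> Y_carrier k)"

definition Y_poset' :: "nat \<Rightarrow> Y_elem poset" where
  "Y_poset' k = dual_poset (Y_poset k)"

text \<open>Binomial coefficients are counted with multiplicity, one for each index from 0 to n.\<close>

definition Sigma_largest :: "nat \<Rightarrow> nat \<Rightarrow> nat" where
  "Sigma_largest n k = sum_list (take k (rev (sort (map (\<lambda>i. n choose i) [0..<n + 1]))))"

end

theory Submission
  imports Defs "HOL-Combinatorics.Multiset_Permutations"
begin

text \<open>The lower bound comes from the union of the levels belonging to the \<^term>\<open>k\<close> largest binomial
coefficients: it has no chain of \<^term>\<open>k + 1\<close> sets, whereas both posets have one.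

For the upper bound, let a family on an \<^term>\<open>n\<close>-element set \<^term>\<open>U\<close> contain neither poset. A
permutation of \<^term>\<open>U\<close> stands for the maximal chain of its prefixes. A chain in the family has at
most \<^term>\<open>k + 1\<close> members, since the \<^term>\<open>k\<close> lowest members of a longer one, with two of the others,
form \<open>Y\<^sub>k\<close>. If the prefixes of a permutation contain a chain of exactly \<^term>\<open>k + 1\<close> members, write
it as \<open>R \<subset> S \<subseteq> \<dots> \<subseteq> S' \<subset> T\<close>. Then \<open>T\<close> is the only member above \<open>S'\<close>, and \<open>R\<close> is the
only member below \<open>S\<close> (\<open>long_chain_ends\<close>). Reverse the part of the permutation after \<open>S'\<close> and the
part inside \<open>S\<close>. If \<open>R\<close> is nonempty and \<open>T\<close> is not the whole of \<^term>\<open>U\<close>, they stop being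
prefixes, no other member becomes one, and exactly \<^term>\<open>k - 1\<close> members remain. The smallest and the
largest of these are \<open>S\<close> and \<open>S'\<close>, so the two reversals can be undone, and the permutations with
\<^term>\<open>k + 1\<close> members are at most as many as those with fewer than \<^term>\<open>k\<close>
(\<open>card_long_le_card_short\<close>). Hence the average number of members on a maximal chain is at most
\<^term>\<open>k\<close>. This average is the LYM sum, that is, the sum of \<open>1 / (n choose |A|)\<close> over the members
\<open>A\<close>.

Bounding the size of the family by its LYM sum leaves a quantified slack: if the sum falls short of
\<^term>\<open>k\<close> by \<open>\<delta>\<close>, then the size falls short of the sum of the \<^term>\<open>k\<close> largest binomial
coefficients by at least \<open>\<delta>\<close> times the smallest of them (\<open>card_le_by_LYM_sum\<close>). This slack
absorbs the empty set and \<^term>\<open>U\<close>, both of which lie on every maximal chain. If exactly one of them is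
a member, discard it. At most \<^term>\<open>k\<close> members then remain on each chain, and fewer on some chain,
because one of the two reversals is still possible; so at least one set is gained. If both are members,
at most \<^term>\<open>k - 1\<close> remain on each chain, so \<open>\<delta>\<close> is at least one. Two sets are gained, because
for \<^term>\<open>k + 1 \<le> n\<close> each of the \<^term>\<open>k\<close> largest binomial coefficients is at least two.\<close>

section \<open>Forbidden configurations as chains with two further bounds\<close>

text \<open>Only the chain and the two further bounds matter. How \<open>y\<close> and \<open>z\<close> compare is left open, since
weak subposets may have additional relations.\<close>

definition contains_Y :: "nat \<Rightarrow> 'a set set \<Rightarrow> bool" where
  "contains_Y k \<F> \<longleftrightarrow> (\<exists>D y z. subset.chain \<F> D \<and> finite D \<and> card D = k \<and>
     y \<in> \<F> - D \<and> z \<in> \<F> - D \<and> y \<noteq> z \<and> (\<forall>d\<in>D. d \<subseteq> y \<and> d \<subseteq> z))"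

definition contains_Y' :: "nat \<Rightarrow> 'a set set \<Rightarrow> bool" where
  "contains_Y' k \<F> \<longleftrightarrow> (\<exists>D y z. subset.chain \<F> D \<and> finite D \<and> card D = k \<and>
     y \<in> \<F> - D \<and> z \<in> \<F> - D \<and> y \<noteq> z \<and> (\<forall>d\<in>D. y \<subseteq> d \<and> z \<subseteq> d))"

lemma weak_subposet_dual: "weak_subposet (dual_poset P) Q \<longleftrightarrow> weak_subposet P (dual_poset Q)"
  unfolding weak_subposet_def dual_poset_def by auto

lemma weak_subposet_Y_posetI:
  assumes "k \<ge> 1" and "refl_on F r" and "trans r"
    and inj: "inj_on e {1..k}" and e: "e ` {1..k} \<subseteq> F"
    and step: "\<And>i. 1 \<le> i \<Longrightarrow> i < k \<Longrightarrow> (e i, e (Suc i)) \<in> r"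
    and yz: "y \<in> F - e ` {1..k}" "z \<in> F - e ` {1..k}" "y \<noteq> z" "(e k, y) \<in> r" "(e k, z) \<in> r"
  shows "weak_subposet (Y_poset k) (F, r)"
proof -
  define \<phi> where "\<phi> u = (case u of X i \<Rightarrow> e i | Y \<Rightarrow> y | Z \<Rightarrow> z)" for u
  have into: "\<phi> u \<in> F" if "u \<in> Y_carrier k" for u
    using that e yz by (auto simp: Y_carrier_def \<phi>_def)
  have "inj_on \<phi> (Y_carrier k)"
  proof (rule inj_onI)
    fix u v assume uv: "u \<in> Y_carrier k" "v \<in> Y_carrier k" "\<phi> u = \<phi> v"
    have mem: "e i \<in> e ` {1..k}" if "X i \<in> Y_carrier k" for i
      using that by (auto simp: Y_carrier_def)
    show "u = v"
      using uv mem yz(1-3) inj_onD[OF inj]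
      by (cases u; cases v) (force simp: \<phi>_def Y_carrier_def)+
  qed
  moreover have "(\<phi> u, \<phi> v) \<in> r" if "(u, v) \<in> (Y_gen k)\<^sup>*" "u \<in> Y_carrier k" for u v
    using that(1)
  proof (induction rule: rtrancl_induct)
    case base
    show ?case using into[OF that(2)] \<open>refl_on F r\<close> by (simp add: refl_onD)
  next
    case (step v w)
    have "(\<phi> v, \<phi> w) \<in> r"
      using step.hyps(2) assms(6) yz(4,5) by (auto simp: Y_gen_def \<phi>_def)
    with step.IH \<open>trans r\<close> show ?case by (blast dest: transD)
  qed
  ultimately show ?thesis
    unfolding weak_subposet_def Y_poset_def using into by (intro exI[of _ \<phi>]) auto
qed

text \<open>Cardinality is strictly monotone on a chain of finite sets, so sorting by it sorts by inclusion.\<close>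

lemma chain_enumeration:
  assumes "subset.chain \<F> D" "finite D" "\<And>A. A \<in> D \<Longrightarrow> finite A"
  obtains xs where "set xs = D" "distinct xs" "sorted_wrt (\<subseteq>) xs"
proof -
  obtain ys where ys: "set ys = D" "distinct ys"
    using finite_distinct_list[OF assms(2)] by auto
  define xs where "xs = sort_key card ys"
  have xs: "set xs = D" "distinct xs" using ys by (auto simp: xs_def)
  have "sorted_wrt (\<lambda>A B. card A \<le> card B) xs"
    using sorted_sort_key[of card ys] by (simp add: xs_def sorted_map)
  then have "sorted_wrt (\<subseteq>) xs"
  proof (rule sorted_wrt_mono_rel[rotated])
    fix A B assume AB: "A \<in> set xs" "B \<in> set xs" "card A \<le> card B"
    then have "A \<subseteq> B \<or> B \<subseteq> A" "finite A"
      using assms xs(1) by (auto simp: subset_chain_def)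
    then show "A \<subseteq> B" using card_seteq[of A B] AB by auto
  qed
  with xs show ?thesis by (rule that)
qed

lemma contains_Y_imp_weak_subposet:
  assumes "contains_Y k F" "k \<ge> 1" "\<And>A. A \<in> F \<Longrightarrow> finite A"
  shows "weak_subposet (Y_poset k) (inclusion_poset F)"
proof -
  obtain D y z where D: "subset.chain F D" "finite D" "card D = k"
    "y \<in> F - D" "z \<in> F - D" "y \<noteq> z" "\<forall>d\<in>D. d \<subseteq> y \<and> d \<subseteq> z"
    using assms(1) unfolding contains_Y_def by (elim exE conjE) (rule that)
  have "D \<subseteq> F" using D(1) by (auto simp: subset_chain_def)
  obtain xs where xs: "set xs = D" "distinct xs" "sorted_wrt (\<subseteq>) xs"
    using chain_enumeration[OF D(1,2)] assms(3) \<open>D \<subseteq> F\<close> by blast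
  have len: "length xs = k" using xs D(3) distinct_card by fastforce
  define e where "e i = xs ! (i - 1)" for i
  have mem: "e i \<in> D" if "i \<in> {1..k}" for i
    using that xs(1) len by (auto simp: e_def)
  then have img: "e ` {1..k} \<subseteq> D" by blast
  let ?r = "{(A, B). A \<in> F \<and> B \<in> F \<and> A \<subseteq> B}"
  have r: "refl_on F ?r" "trans ?r"
    by (auto simp: refl_on_def trans_def)
  show ?thesis
    unfolding inclusion_poset_def
  proof (rule weak_subposet_Y_posetI[OF assms(2) r, of e y z])
    show "inj_on e {1..k}"
      using xs(2) len by (auto simp: inj_on_def e_def nth_eq_iff_index_eq)
    fix i assume i: "1 \<le> i" "i < k"
    then have "e i \<subseteq> e (Suc i)"
      using sorted_wrt_nth_less[OF xs(3), of "i - 1" i] len by (simp add: e_def)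
    then show "(e i, e (Suc i)) \<in> ?r"
      using mem[of i] mem[of "Suc i"] i \<open>D \<subseteq> F\<close> by auto
  next
    have "e k \<in> D" using mem assms(2) by simp
    with D(4,5,7) \<open>D \<subseteq> F\<close> show "(e k, y) \<in> ?r" "(e k, z) \<in> ?r" by auto
  qed (use D(4,5,6) img \<open>D \<subseteq> F\<close> in blast)+
qed

lemma contains_Y'_imp_weak_subposet:
  assumes "contains_Y' k F" "k \<ge> 1" "\<And>A. A \<in> F \<Longrightarrow> finite A"
  shows "weak_subposet (Y_poset' k) (inclusion_poset F)"
proof -
  obtain D y z where D: "subset.chain F D" "finite D" "card D = k"
    "y \<in> F - D" "z \<in> F - D" "y \<noteq> z" "\<forall>d\<in>D. y \<subseteq> d \<and> z \<subseteq> d"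
    using assms(1) unfolding contains_Y'_def by (elim exE conjE) (rule that)
  have "D \<subseteq> F" using D(1) by (auto simp: subset_chain_def)
  obtain xs where xs: "set xs = D" "distinct xs" "sorted_wrt (\<subseteq>) xs"
    using chain_enumeration[OF D(1,2)] assms(3) \<open>D \<subseteq> F\<close> by blast
  have len: "length xs = k" using xs D(3) distinct_card by fastforce
  define e where "e i = xs ! (k - i)" for i
  have mem: "e i \<in> D" if "i \<in> {1..k}" for i
    using that xs(1) len by (auto simp: e_def)
  then have img: "e ` {1..k} \<subseteq> D" by blast
  let ?r = "{(A, B). A \<in> F \<and> B \<in> F \<and> B \<subseteq> A}"
  have r: "refl_on F ?r" "trans ?r"
    by (auto simp: refl_on_def trans_def)
  have "weak_subposet (Y_poset k) (F, ?r)"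
  proof (rule weak_subposet_Y_posetI[OF assms(2) r, of e y z])
    show "inj_on e {1..k}"
      using xs(2) len by (auto simp: inj_on_def e_def nth_eq_iff_index_eq)
    fix i assume i: "1 \<le> i" "i < k"
    then have "e (Suc i) \<subseteq> e i"
      using sorted_wrt_nth_less[OF xs(3), of "k - Suc i" "k - i"] len by (simp add: e_def)
    then show "(e i, e (Suc i)) \<in> ?r"
      using mem[of i] mem[of "Suc i"] i \<open>D \<subseteq> F\<close> by auto
  next
    have "e k \<in> D" using mem assms(2) by simp
    with D(4,5,7) \<open>D \<subseteq> F\<close> show "(e k, y) \<in> ?r" "(e k, z) \<in> ?r" by auto
  qed (use D(4,5,6) img \<open>D \<subseteq> F\<close> in blast)+
  moreover have "(F, ?r) = dual_poset (inclusion_poset F)"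
    by (auto simp: dual_poset_def inclusion_poset_def)
  ultimately show ?thesis
    by (simp add: Y_poset'_def weak_subposet_dual)
qed

section \<open>Chains inside a Y-free and Y'-free family\<close>

lemma subset_chain_mono: "subset.chain F K \<Longrightarrow> L \<subseteq> K \<Longrightarrow> subset.chain F L"
  unfolding subset_chain_def by blast

lemma lower_part_of_chain:
  assumes "subset.chain F K" "finite K" "m \<le> card K"
  obtains D where "D \<subseteq> K" "card D = m" "\<And>d e. d \<in> D \<Longrightarrow> e \<in> K - D \<Longrightarrow> d \<subseteq> e"
  using assms(3)
proof (induction m arbitrary: thesis)
  case 0
  show ?case by (rule 0(1)[of "{}"]) auto
next
  case (Suc m)
  obtain D where D: "D \<subseteq> K" "card D = m" "\<And>d e. d \<in> D \<Longrightarrow> e \<in> K - D \<Longrightarrow> d \<subseteq> e"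
    using Suc.IH Suc.prems(2) by (metis Suc_leD)
  have "K - D \<noteq> {}" using D Suc.prems(2) by force
  moreover have ch: "subset.chain F (K - D)"
    using subset_chain_mono[OF assms(1)] by blast
  ultimately have min: "\<Inter>(K - D) \<in> K - D"
    using Inter_in_chain[of "K - D" F] assms(2) by blast
  show ?case
  proof (rule Suc.prems(1)[of "insert (\<Inter>(K - D)) D"])
    show "card (insert (\<Inter>(K - D)) D) = Suc m"
      using min D(1,2) assms(2) finite_subset by fastforce
  qed (use D min in auto)
qed

text \<open>Above the \<^term>\<open>k\<close> lowest members of a longer chain there would be two more members, and being
comparable they still serve as the two upper bounds.\<close>

lemma card_chain_le:
  assumes "subset.chain F K" "finite K" "\<not> contains_Y k F"
  shows "card K \<le> k + 1"
proof (rule ccontr)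
  assume "\<not> ?thesis"
  then have big: "card K \<ge> k + 2" by simp
  obtain D where D: "D \<subseteq> K" "card D = k" "\<And>d e. d \<in> D \<Longrightarrow> e \<in> K - D \<Longrightarrow> d \<subseteq> e"
    using lower_part_of_chain[OF assms(1,2), of k] big by auto
  have "finite D" using D(1) assms(2) finite_subset by blast
  have "card (K - D) \<ge> 2"
    using big D \<open>finite D\<close> by (simp add: card_Diff_subset)
  then obtain y z where yz: "y \<in> K - D" "z \<in> K - D" "y \<noteq> z"
    by (metis card_le_Suc0_iff_eq assms(2) finite_Diff not_less_eq_eq numeral_2_eq_2)
  have "contains_Y k F"
    unfolding contains_Y_def
  proof (intro exI conjI ballI)
    show "subset.chain F D" using subset_chain_mono[OF assms(1) D(1)] .
    show "y \<in> F - D" "z \<in> F - D" using yz assms(1) by (auto simp: subset_chain_def)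
  qed (use D(2,3) yz \<open>finite D\<close> in auto)
  with assms(3) show False by blast
qed

text \<open>With its \<^term>\<open>k\<close> lowest members, a second member of the family above all of them would complete
\<open>Y\<^sub>k\<close> beside \<open>T\<close>; dually at the bottom. The inner part of the chain is nonempty because
\<^term>\<open>k \<ge> 2\<close>, and its extreme members are expressed as intersection and union so that they
can be read off from the inner part alone.\<close>

lemma long_chain_ends:
  assumes ch: "subset.chain F K" and fin: "finite K" and card: "card K = k + 1" and "k \<ge> 2"
    and noY: "\<not> contains_Y k F" and noY': "\<not> contains_Y' k F"
  obtains R S S' T where "R \<in> K" "T \<in> K" "R \<noteq> T" "S \<in> K - {R, T}" "S' \<in> K - {R, T}"
    "\<Inter>(K - {R, T}) = S" "\<Union>(K - {R, T}) = S'" "R \<subset> S" "S' \<subset> T"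
    "\<And>B. B \<in> F \<Longrightarrow> S' \<subset> B \<Longrightarrow> B = T" "\<And>B. B \<in> F \<Longrightarrow> B \<subset> S \<Longrightarrow> B = R"
proof -
  have KF: "K \<subseteq> F" using ch by (auto simp: subset_chain_def)
  have sub: "subset.chain F L" if "L \<subseteq> K" for L
    using subset_chain_mono[OF ch that] .
  obtain D where D: "D \<subseteq> K" "card D = k" "\<And>d e. d \<in> D \<Longrightarrow> e \<in> K - D \<Longrightarrow> d \<subseteq> e"
    using lower_part_of_chain[OF ch fin, of k] card by auto
  have finD: "finite D" using D(1) fin finite_subset by blast
  have "card (K - D) = 1" using D finD card by (simp add: card_Diff_subset)
  then obtain T where T: "K - D = {T}" by (rule card_1_singletonE)
  obtain E where E: "E \<subseteq> K" "card E = 1" "\<And>d e. d \<in> E \<Longrightarrow> e \<in> K - E \<Longrightarrow> d \<subseteq> e"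
    using lower_part_of_chain[OF ch fin, of 1] card by auto
  obtain R where R: "E = {R}" using E(2) by (rule card_1_singletonE)
  have "card (K - {R}) = k" using E R card by simp
  have above: "B = T" if "B \<in> F" "B \<notin> D" "\<forall>d\<in>D. d \<subseteq> B" for B
  proof (rule ccontr)
    assume "B \<noteq> T"
    then have "contains_Y k F"
      unfolding contains_Y_def
      by (intro exI[of _ D] exI[of _ B] exI[of _ T])
        (use that D T finD KF sub in auto)
    with noY show False by blast
  qed
  have below: "B = R" if "B \<in> F" "B \<notin> K - {R}" "\<forall>d\<in>K - {R}. B \<subseteq> d" for B
  proof (rule ccontr)
    assume "B \<noteq> R"
    then have "contains_Y' k F"
      unfolding contains_Y'_def
      by (intro exI[of _ "K - {R}"] exI[of _ B] exI[of _ R])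
        (use that E R fin \<open>card (K - {R}) = k\<close> KF sub[of "K - {R}"] in auto)
    with noY' show False by blast
  qed
  have DK: "D = K - {T}" "T \<in> K" using D(1) T by auto
  have RK: "R \<in> K" using E R by auto
  have "R \<noteq> T"
  proof
    assume "R = T"
    obtain d where "d \<in> D" using D(2) \<open>k \<ge> 2\<close> by fastforce
    then have "d \<subseteq> T" "T \<subseteq> d" "d \<noteq> T"
      using D(3)[of d T] E(3)[of R d] R T DK \<open>R = T\<close> by auto
    then show False by auto
  qed
  let ?C = "K - {R, T}"
  have "card ?C = k - 1"
    using card \<open>R \<noteq> T\<close> RK DK by (simp add: card_Diff_subset)
  then have ne: "?C \<noteq> {}"
    using \<open>k \<ge> 2\<close>
    by (metis card.empty not_one_le_zero One_nat_def diff_is_0_eq not_less_eq_eq numeral_2_eq_2)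
  have fC: "finite ?C" using fin by simp
  define S where "S = \<Inter>?C"
  define S' where "S' = \<Union>?C"
  have S: "S \<in> ?C"
    unfolding S_def by (rule Inter_in_chain[OF fC ne sub]) auto
  have S': "S' \<in> ?C"
    unfolding S'_def by (rule Union_in_chain[OF fC ne sub]) auto
  have lt: "R \<subset> S" using E(3)[of R S] S R by auto
  have lt': "S' \<subset> T" using D(3)[of S' T] S' DK by auto
  have SS': "S \<subseteq> S'" using S unfolding S'_def by blast
  show ?thesis
  proof (rule that[OF RK DK(2) \<open>R \<noteq> T\<close> S S' S_def[symmetric] S'_def[symmetric] lt lt'])
    fix B assume B: "B \<in> F" "S' \<subset> B"
    have up: "d \<subseteq> S'" if "d \<in> D" for d
    proof (cases "d = R")
      case True
      then show ?thesis using lt SS' by blast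
    next
      case False
      then show ?thesis using that DK unfolding S'_def by blast
    qed
    show "B = T" by (rule above) (use B up in auto)
  next
    fix B assume B: "B \<in> F" "B \<subset> S"
    have dn: "S \<subseteq> d" if "d \<in> K - {R}" for d
    proof (cases "d = T")
      case True
      then show ?thesis using lt' SS' by blast
    next
      case False
      then show ?thesis using that unfolding S_def by blast
    qed
    show "B = R" by (rule below) (use B dn in auto)
  qed
qed

section \<open>Maximal chains as permutations\<close>

definition prefix_sets :: "'a list \<Rightarrow> 'a set set" where
  "prefix_sets xs = (\<lambda>i. set (take i xs)) ` {..length xs}"

text \<open>A prefix is determined by its size.\<close>

lemma prefix_sets_iff:
  assumes "distinct xs"
  shows "A \<in> prefix_sets xs \<longleftrightarrow> set (take (card A) xs) = A"
proof
  assume "A \<in> prefix_sets xs"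
  then obtain i where i: "i \<le> length xs" "A = set (take i xs)"
    by (auto simp: prefix_sets_def)
  then have "card A = i" using assms by (simp add: distinct_card)
  with i show "set (take (card A) xs) = A" by simp
next
  assume *: "set (take (card A) xs) = A"
  then have "A = set (take (min (card A) (length xs)) xs)"
    by (cases "card A \<le> length xs") (simp_all add: min_def)
  then show "A \<in> prefix_sets xs"
    unfolding prefix_sets_def by (rule image_eqI) simp
qed

lemma finite_prefix_sets [simp]: "finite (prefix_sets xs)"
  by (simp add: prefix_sets_def)

lemma chain_prefix_sets: "subset.chain F (F \<inter> prefix_sets xs)"
proof -
  have "A \<subseteq> B \<or> B \<subseteq> A" if AB: "A \<in> prefix_sets xs" "B \<in> prefix_sets xs" for A B
  proof -
    obtain i j where "A = set (take i xs)" "B = set (take j xs)"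
      using AB by (auto simp: prefix_sets_def)
    then show ?thesis
      using set_take_subset_set_take[of i j xs] set_take_subset_set_take[of j i xs]
      by (meson nat_le_linear)
  qed
  then show ?thesis by (auto simp: subset_chain_def)
qed

lemma prefix_sets_ends: "{} \<in> prefix_sets xs" "set xs \<in> prefix_sets xs"
proof -
  show "{} \<in> prefix_sets xs"
    unfolding prefix_sets_def by (rule image_eqI[of _ _ 0]) simp_all
  show "set xs \<in> prefix_sets xs"
    unfolding prefix_sets_def by (rule image_eqI[of _ _ "length xs"]) simp_all
qed

text \<open>Two involutions on permutations: the first fixes all prefixes of size at most \<open>b\<close>, the second all
prefix sets of size at least \<open>a\<close>. Reversal is preferred to rotation because it is its own inverse and
moves every prefix set strictly inside the reversed segment.\<close>

definition flip_above :: "nat \<Rightarrow> 'a list \<Rightarrow> 'a list" where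
  "flip_above b xs = take b xs @ rev (drop b xs)"

definition flip_below :: "nat \<Rightarrow> 'a list \<Rightarrow> 'a list" where
  "flip_below a xs = rev (take a xs) @ drop a xs"

lemma flip_above_flip_above: "flip_above b (flip_above b xs) = xs"
  by (cases "b \<le> length xs") (auto simp: flip_above_def)

lemma flip_below_flip_below: "flip_below a (flip_below a xs) = xs"
  by (cases "a \<le> length xs") (auto simp: flip_below_def)

lemma set_flip_above [simp]: "set (flip_above b xs) = set xs"
proof -
  have "set xs = set (take b xs @ drop b xs)" by simp
  then show ?thesis unfolding flip_above_def by (simp del: append_take_drop_id)
qed

lemma set_flip_below [simp]: "set (flip_below b xs) = set xs"
proof -
  have "set xs = set (take b xs @ drop b xs)" by simp
  then show ?thesis unfolding flip_below_def by (simp del: append_take_drop_id)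
qed

lemma length_flips [simp]:
  "length (flip_above b xs) = length xs" "length (flip_below b xs) = length xs"
  by (auto simp: flip_above_def flip_below_def)

lemma distinct_flips [simp]:
  "distinct (flip_above b xs) = distinct xs" "distinct (flip_below b xs) = distinct xs"
proof -
  have "distinct ys \<longleftrightarrow> card (set ys) = length ys" for ys :: "'a list"
    using card_distinct distinct_card by blast
  then show "distinct (flip_above b xs) = distinct xs" "distinct (flip_below b xs) = distinct xs"
    by simp_all
qed

text \<open>A member larger than \<open>S\<close> is a prefix before or after the flip only if it lies above \<open>S\<close>, so \<open>T\<close>
is the only candidate. It is lost because the last entry, which is missing from \<open>T\<close>, moves to the
position just after \<open>S\<close>.\<close>

lemma family_prefixes_flip_above:
  assumes dist: "distinct xs" and S: "S \<in> prefix_sets xs" and T: "T \<in> F" "T \<in> prefix_sets xs"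
    and ST: "S \<subset> T" "T \<noteq> set xs" and unique: "\<And>B. B \<in> F \<Longrightarrow> S \<subset> B \<Longrightarrow> B = T"
  shows "F \<inter> prefix_sets (flip_above (card S) xs) = F \<inter> prefix_sets xs - {T}"
proof -
  let ?b = "card S" and ?t = "card T" and ?ys = "flip_above (card S) xs"
  have S_eq: "set (take ?b xs) = S" and T_eq: "set (take ?t xs) = T"
    using S T dist by (auto simp: prefix_sets_iff)
  have "finite T" by (metis T_eq List.finite_set)
  then have bt: "?b < ?t" using ST(1) by (rule psubset_card_mono)
  have t_len: "?t < length xs"
    using T_eq ST(2) by (metis not_le take_all)
  have same: "take i ?ys = take i xs" if "i \<le> ?b" for i
    using that bt t_len by (simp add: flip_above_def)
  have aboveS: "S \<subset> B" if "set (take (card B) zs) = B" "take ?b zs = take ?b xs" "?b < card B" for B zs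
  proof -
    have "S \<subseteq> B"
      using set_take_subset_set_take[of ?b "card B" zs] that S_eq by simp
    with that(3) show ?thesis by auto
  qed
  have "T \<notin> prefix_sets ?ys"
  proof
    assume "T \<in> prefix_sets ?ys"
    then have eq: "set (take ?t ?ys) = set (take ?t xs)"
      using dist T_eq by (simp add: prefix_sets_iff)
    have "xs \<noteq> []" using t_len by auto
    then have "last xs = ?ys ! ?b"
      using bt t_len by (simp add: flip_above_def nth_append rev_nth last_conv_nth)
    also have "\<dots> \<in> set (take ?t ?ys)"
      using bt t_len by (auto simp: in_set_conv_nth intro!: exI[of _ ?b])
    finally have "last xs \<in> set (take ?t xs)" using eq by simp
    moreover have "last xs \<in> set (drop ?t xs)"
      using t_len by (metis drop_eq_Nil last_drop last_in_set not_le)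
    moreover have "set (take ?t xs) \<inter> set (drop ?t xs) = {}"
      using dist by (simp add: set_take_disj_set_drop_if_distinct)
    ultimately show False by blast
  qed
  moreover have "B \<in> prefix_sets ?ys \<longleftrightarrow> B \<in> prefix_sets xs" if B: "B \<in> F" "B \<noteq> T" for B
  proof (cases "card B \<le> ?b")
    case True
    then show ?thesis using same dist by (simp add: prefix_sets_iff)
  next
    case False
    then show ?thesis
      using aboveS[of B xs] aboveS[of B ?ys] same[of ?b] unique[of B] B dist
      by (auto simp: prefix_sets_iff)
  qed
  ultimately show ?thesis by blast
qed

text \<open>The mirror image: \<open>R\<close> contains the first entry, which the flip moves to the end of \<open>S\<close>.\<close>

lemma family_prefixes_flip_below:
  assumes dist: "distinct xs" and S: "S \<in> prefix_sets xs" and R: "R \<in> F" "R \<in> prefix_sets xs"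
    and RS: "R \<subset> S" "R \<noteq> {}" and unique: "\<And>B. B \<in> F \<Longrightarrow> B \<subset> S \<Longrightarrow> B = R"
  shows "F \<inter> prefix_sets (flip_below (card S) xs) = F \<inter> prefix_sets xs - {R}"
proof -
  let ?a = "card S" and ?r = "card R" and ?ys = "flip_below (card S) xs"
  have S_eq: "set (take ?a xs) = S" and R_eq: "set (take ?r xs) = R"
    using S R dist by (auto simp: prefix_sets_iff)
  have "finite S" by (metis S_eq List.finite_set)
  then have ra: "?r < ?a" using RS(1) by (rule psubset_card_mono)
  have r0: "?r > 0" using R_eq RS(2) by (metis gr0I list.set(1) take0)
  have a_len: "?a \<le> length xs"
    using S_eq dist by (metis distinct_card distinct_take length_take min.cobounded1)
  have same: "set (take i ?ys) = set (take i xs)" if "i \<ge> ?a" for i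
  proof -
    have "take i ?ys = rev (take ?a xs) @ take (i - ?a) (drop ?a xs)"
      using that a_len by (simp add: flip_below_def)
    moreover have "take i xs = take ?a xs @ take (i - ?a) (drop ?a xs)"
      using that by (metis le_add_diff_inverse take_add)
    ultimately show ?thesis by simp
  qed
  have belowS: "B \<subset> S" if "set (take (card B) zs) = B" "set (take ?a zs) = S" "card B < ?a" for B zs
  proof -
    have "B \<subseteq> S"
      using set_take_subset_set_take[of "card B" ?a zs] that by simp
    with that(3) show ?thesis by auto
  qed
  have "R \<notin> prefix_sets ?ys"
  proof
    assume "R \<in> prefix_sets ?ys"
    then have eq: "set (take ?r ?ys) = set (take ?r xs)"
      using dist R_eq by (simp add: prefix_sets_iff)
    have "xs \<noteq> []" using a_len ra by auto
    then have "hd xs \<in> set (take ?r xs)"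
      using r0 by (cases xs; cases ?r) auto
    then have "hd xs \<in> set (take ?r ?ys)" using eq by simp
    moreover have "take ?r ?ys = rev (drop (?a - ?r) (take ?a xs))"
      using ra a_len by (simp add: flip_below_def take_rev)
    ultimately have "hd xs \<in> set (drop (?a - ?r) (take ?a xs))" by simp
    then have "hd xs \<in> set (drop (?a - ?r) xs)"
      by (metis drop_take in_set_takeD)
    then have "hd xs \<in> set (drop 1 xs)"
      using set_drop_subset_set_drop[of 1 "?a - ?r" xs] ra
      by (metis One_nat_def Suc_leI subsetD zero_less_diff)
    then show False using dist \<open>xs \<noteq> []\<close> by (cases xs) auto
  qed
  moreover have "B \<in> prefix_sets ?ys \<longleftrightarrow> B \<in> prefix_sets xs" if B: "B \<in> F" "B \<noteq> R" for B
  proof (cases "card B \<ge> ?a")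
    case True
    then show ?thesis using same dist by (simp add: prefix_sets_iff)
  next
    case False
    then show ?thesis
      using belowS[of B xs] belowS[of B ?ys] same[of ?a] S_eq unique[of B] B dist
      by (auto simp: prefix_sets_iff)
  qed
  ultimately show ?thesis by blast
qed

section \<open>The LYM sum of a Y-free and Y'-free family\<close>

lemma card_permutations_with_prefix:
  assumes "finite U" "A \<subseteq> U"
  shows "card {xs \<in> permutations_of_set U. A \<in> prefix_sets xs}
    = fact (card A) * fact (card U - card A)"
proof -
  have "finite A" using assms finite_subset by blast
  have "{xs \<in> permutations_of_set U. A \<in> prefix_sets xs}
      = (\<lambda>(p, q). p @ q) ` (permutations_of_set A \<times> permutations_of_set (U - A))"
    (is "?L = ?R")
  proof (intro equalityI subsetI)
    fix xs assume xs: "xs \<in> ?L"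
    then have d: "distinct xs" "set xs = U" and A: "set (take (card A) xs) = A"
      by (auto dest: permutations_of_setD simp: prefix_sets_iff)
    have "set (take (card A) xs) \<inter> set (drop (card A) xs) = {}"
      using d(1) by (simp add: set_take_disj_set_drop_if_distinct)
    moreover have "set (take (card A) xs) \<union> set (drop (card A) xs) = U"
      using d(2) by (metis append_take_drop_id set_append)
    ultimately have "set (drop (card A) xs) = U - A" using A by blast
    then have "(take (card A) xs, drop (card A) xs)
        \<in> permutations_of_set A \<times> permutations_of_set (U - A)"
      using A d(1) by auto
    then show "xs \<in> ?R" by (rule rev_image_eqI) simp
  next
    fix xs assume "xs \<in> ?R"
    then obtain p q where "xs = p @ q"
      and "p \<in> permutations_of_set A" "q \<in> permutations_of_set (U - A)"
      by auto
    then have pq: "xs = p @ q" "set p = A" "distinct p" "set q = U - A" "distinct q"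
      by (simp_all add: permutations_of_setD)
    then have "length p = card A" using distinct_card by fastforce
    with pq assms(2) show "xs \<in> ?L"
      by (auto simp: prefix_sets_iff intro!: permutations_of_setI)
  qed
  moreover have "inj_on (\<lambda>(p, q). p @ q) (permutations_of_set A \<times> permutations_of_set (U - A))"
    by (rule inj_onI) (auto dest!: length_finite_permutations_of_set)
  ultimately show ?thesis
    using assms \<open>finite A\<close> by (simp add: card_image card_cartesian_product card_Diff_subset)
qed

text \<open>Double counting of the pairs of a permutation and a member of the family that is one of its
prefixes.\<close>

lemma sum_card_family_prefixes:
  assumes "finite U" "F \<subseteq> Pow U"
  shows "(\<Sum>xs\<in>permutations_of_set U. real (card (F \<inter> prefix_sets xs)))
    = fact (card U) * (\<Sum>A\<in>F. 1 / real (card U choose card A))"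
proof -
  let ?P = "permutations_of_set U"
  have finF: "finite F" using assms finite_subset by blast
  have "(\<Sum>xs\<in>?P. real (card (F \<inter> prefix_sets xs)))
      = (\<Sum>xs\<in>?P. \<Sum>A\<in>F. of_bool (A \<in> prefix_sets xs))"
    using finF by (simp add: sum_of_bool_eq Int_def)
  also have "\<dots> = (\<Sum>A\<in>F. \<Sum>xs\<in>?P. of_bool (A \<in> prefix_sets xs))"
    by (rule sum.swap)
  also have "\<dots> = (\<Sum>A\<in>F. real (card {xs \<in> ?P. A \<in> prefix_sets xs}))"
    by (simp add: sum_of_bool_eq Int_def)
  also have "\<dots> = (\<Sum>A\<in>F. fact (card U) * (1 / real (card U choose card A)))"
  proof (rule sum.cong)
    fix A assume "A \<in> F"
    then have A: "A \<subseteq> U" using assms(2) by blast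
    then have "card A \<le> card U" using assms(1) card_mono by blast
    then show "real (card {xs \<in> ?P. A \<in> prefix_sets xs})
        = fact (card U) * (1 / real (card U choose card A))"
      using card_permutations_with_prefix[OF assms(1) A]
      by (simp add: binomial_fact)
  qed simp
  finally show ?thesis by (simp add: sum_distrib_left)
qed

lemma card_family_prefixes_le:
  assumes "\<not> contains_Y k F"
  shows "card (F \<inter> prefix_sets xs) \<le> k + 1"
  using card_chain_le[OF chain_prefix_sets _ assms] by simp

text \<open>The map from long to short permutations that flips both ends is injective, because the members that
survive reveal where the flips took place. This is expressed by an explicit left inverse \<open>unflip\<close>,
whose image of the short permutations covers the long ones.\<close>

lemma card_long_le_card_short:
  assumes "finite U" "F \<subseteq> Pow U" "k \<ge> 2" "\<not> contains_Y k F" "\<not> contains_Y' k F"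
    and "{} \<notin> F" "U \<notin> F"
  shows "card {xs \<in> permutations_of_set U. card (F \<inter> prefix_sets xs) = k + 1}
    \<le> card {xs \<in> permutations_of_set U. card (F \<inter> prefix_sets xs) < k}"
    (is "card ?long \<le> card ?short")
proof -
  define unflip where "unflip ys = flip_above (card (\<Union>(F \<inter> prefix_sets ys)))
    (flip_below (card (\<Inter>(F \<inter> prefix_sets ys))) ys)" for ys :: "'a list"
  have "?long \<subseteq> unflip ` ?short"
  proof
    fix xs assume "xs \<in> ?long"
    then have "xs \<in> permutations_of_set U" and card: "card (F \<inter> prefix_sets xs) = k + 1"
      by simp_all
    then have xs: "distinct xs" "set xs = U" by (simp_all add: permutations_of_setD)
    let ?K = "F \<inter> prefix_sets xs"
    obtain R S S' T where *: "R \<in> ?K" "T \<in> ?K" "R \<noteq> T" "S \<in> ?K - {R, T}" "S' \<in> ?K - {R, T}"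
      and core: "\<Inter>(?K - {R, T}) = S" "\<Union>(?K - {R, T}) = S'" and less: "R \<subset> S" "S' \<subset> T"
      and top: "\<And>B. B \<in> F \<Longrightarrow> S' \<subset> B \<Longrightarrow> B = T"
      and bot: "\<And>B. B \<in> F \<Longrightarrow> B \<subset> S \<Longrightarrow> B = R"
      by (rule long_chain_ends[OF chain_prefix_sets _ card assms(3-5)]) (simp, rule that)
    define zs where "zs = flip_above (card S') xs"
    define ys where "ys = flip_below (card S) zs"
    have "T \<noteq> set xs" using assms(7) * xs by auto
    then have zs: "F \<inter> prefix_sets zs = ?K - {T}"
      unfolding zs_def using * less top xs
      by (intro family_prefixes_flip_above) auto
    have dzs: "distinct zs" using xs by (simp add: zs_def)
    have Rz: "R \<in> F \<inter> prefix_sets zs" "S \<in> F \<inter> prefix_sets zs" using zs * by auto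
    have "R \<noteq> {}" using assms(6) * by auto
    then have "F \<inter> prefix_sets ys = F \<inter> prefix_sets zs - {R}"
      unfolding ys_def using Rz less bot dzs
      by (intro family_prefixes_flip_below) auto
    then have ys: "F \<inter> prefix_sets ys = ?K - {R, T}" using zs by auto
    have "card (F \<inter> prefix_sets ys) < k"
      unfolding ys using card * \<open>k \<ge> 2\<close> by (simp add: card_Diff_subset)
    moreover have "ys \<in> permutations_of_set U"
      using xs by (intro permutations_of_setI) (auto simp: ys_def zs_def)
    moreover have "xs = unflip ys"
      unfolding unflip_def ys core
      by (simp add: ys_def zs_def flip_below_flip_below flip_above_flip_above)
    ultimately show "xs \<in> unflip ` ?short" by blast
  qed
  then show ?thesis by (rule surj_card_le[rotated]) simp
qed

text \<open>Each permutation carries at most \<^term>\<open>k\<close> members, up to an excess of one on the long permutations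
that the deficit on the short ones outweighs.\<close>

lemma LYM_sum_le:
  assumes "finite U" "F \<subseteq> Pow U" "k \<ge> 2" "\<not> contains_Y k F" "\<not> contains_Y' k F"
    and "{} \<notin> F" "U \<notin> F"
  shows "(\<Sum>A\<in>F. 1 / real (card U choose card A)) \<le> real k"
proof -
  let ?P = "permutations_of_set U" and ?h = "\<lambda>xs. card (F \<inter> prefix_sets xs)"
  have "(\<Sum>xs\<in>?P. real (?h xs) + of_bool (?h xs < k))
      \<le> (\<Sum>xs\<in>?P. real k + of_bool (?h xs = k + 1))"
  proof (rule sum_mono)
    fix xs
    show "real (?h xs) + of_bool (?h xs < k) \<le> real k + of_bool (?h xs = k + 1)"
      using card_family_prefixes_le[OF assms(4), of xs] by (auto simp: of_bool_def)
  qed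
  also have "\<dots> = real k * fact (card U) + real (card {xs \<in> ?P. ?h xs = k + 1})"
    using assms(1) by (simp add: sum.distrib sum_of_bool_eq Int_def)
  also have "\<dots> \<le> real k * fact (card U) + real (card {xs \<in> ?P. ?h xs < k})"
    using card_long_le_card_short[OF assms] by simp
  finally have "(\<Sum>xs\<in>?P. real (?h xs)) \<le> real k * fact (card U)"
    by (simp add: sum.distrib sum_of_bool_eq Int_def)
  then show ?thesis
    by (simp add: sum_card_family_prefixes[OF assms(1,2)] mult.commute)
qed

text \<open>Flipping only the end at which \<open>{}\<close> or \<^term>\<open>U\<close> is absent already shortens a long chain.\<close>

lemma exists_permutation_not_long:
  assumes "finite U" "F \<subseteq> Pow U" "k \<ge> 2" "\<not> contains_Y k F" "\<not> contains_Y' k F"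
    and "{} \<notin> F \<or> U \<notin> F"
  obtains xs where "xs \<in> permutations_of_set U" "card (F \<inter> prefix_sets xs) \<le> k"
proof -
  obtain xs where xs: "distinct xs" "set xs = U"
    using finite_distinct_list[OF assms(1)] by blast
  let ?K = "F \<inter> prefix_sets xs"
  consider "card ?K \<le> k" | "card ?K = k + 1"
    using card_family_prefixes_le[OF assms(4), of xs] by linarith
  then show ?thesis
  proof cases
    case 1
    then show ?thesis using that[of xs] xs by blast
  next
    case 2
    obtain R S S' T where *: "R \<in> ?K" "T \<in> ?K" "R \<noteq> T" "S \<in> ?K - {R, T}" "S' \<in> ?K - {R, T}"
      and "\<Inter>(?K - {R, T}) = S" "\<Union>(?K - {R, T}) = S'"
      and less: "R \<subset> S" "S' \<subset> T"
      and top: "\<And>B. B \<in> F \<Longrightarrow> S' \<subset> B \<Longrightarrow> B = T"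
      and bot: "\<And>B. B \<in> F \<Longrightarrow> B \<subset> S \<Longrightarrow> B = R"
      by (rule long_chain_ends[OF chain_prefix_sets _ 2 assms(3-5)]) (simp, rule that)
    show ?thesis
    proof (cases "U \<in> F")
      case False
      then have "T \<noteq> set xs" using * xs by auto
      then have "F \<inter> prefix_sets (flip_above (card S') xs) = ?K - {T}"
        using * less top xs by (intro family_prefixes_flip_above) auto
      then have "card (F \<inter> prefix_sets (flip_above (card S') xs)) \<le> k"
        using 2 *(2) by simp
      then show ?thesis
        using xs by (intro that[of "flip_above (card S') xs"] permutations_of_setI) simp_all
    next
      case True
      then have "R \<noteq> {}" using * assms(6) by auto
      then have "F \<inter> prefix_sets (flip_below (card S) xs) = ?K - {R}"
        using * less bot xs by (intro family_prefixes_flip_below) auto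
      then have "card (F \<inter> prefix_sets (flip_below (card S) xs)) \<le> k"
        using 2 *(1) by simp
      then show ?thesis
        using xs by (intro that[of "flip_below (card S) xs"] permutations_of_setI) simp_all
    qed
  qed
qed

section \<open>From the LYM sum to the sum of the largest binomial coefficients\<close>

lemma sum_over_levels:
  fixes g :: "nat \<Rightarrow> 'b :: semiring_1"
  assumes "finite U" "finite J"
  shows "(\<Sum>A | A \<subseteq> U \<and> card A \<in> J. g (card A)) = (\<Sum>i\<in>J. of_nat (card U choose i) * g i)"
proof -
  have "(\<Sum>A | A \<subseteq> U \<and> card A \<in> J. g (card A))
      = (\<Sum>i\<in>J. \<Sum>A | A \<in> {A. A \<subseteq> U \<and> card A \<in> J} \<and> card A = i. g (card A))"
    by (rule sum.group[symmetric]) (use assms in auto)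
  also have "\<dots> = (\<Sum>i\<in>J. of_nat (card U choose i) * g i)"
  proof (rule sum.cong[OF refl])
    fix i assume "i \<in> J"
    then have eq: "{A \<in> {A. A \<subseteq> U \<and> card A \<in> J}. card A = i} = {A. A \<subseteq> U \<and> card A = i}" by auto
    show "(\<Sum>A | A \<in> {A. A \<subseteq> U \<and> card A \<in> J} \<and> card A = i. g (card A))
        = of_nat (card U choose i) * g i"
      unfolding eq using n_subsets[OF assms(1), of i] by simp
  qed
  finally show ?thesis .
qed

text \<open>The left-hand side is \<^term>\<open>m * real (card J)\<close> plus the sum of the weights \<open>1 - m / (n choose |A|)\<close>
over the family. These weights are nonnegative on the levels in \<^term>\<open>J\<close> and nonpositive elsewhere,
so the full levels in \<^term>\<open>J\<close> maximise their sum.\<close>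

lemma card_le_by_LYM_sum:
  fixes m :: real
  assumes "finite U" "F \<subseteq> Pow U" "J \<subseteq> {..card U}"
    and large: "\<And>i. i \<in> J \<Longrightarrow> m \<le> real (card U choose i)"
    and small: "\<And>i. i \<in> {..card U} - J \<Longrightarrow> real (card U choose i) \<le> m"
  shows "real (card F) + m * (real (card J) - (\<Sum>A\<in>F. 1 / real (card U choose card A)))
    \<le> real (\<Sum>i\<in>J. card U choose i)"
proof -
  let ?c = "\<lambda>A. real (card U choose card A)" and ?L = "{A. A \<subseteq> U \<and> card A \<in> J}"
  have finF: "finite F" using assms finite_subset by blast
  have finJ: "finite J" using assms(3) finite_subset by blast
  have pos: "?c A > 0" if "A \<subseteq> U" for A
    using that assms(1) by (simp add: card_mono)
  have "real (card F) - m * (\<Sum>A\<in>F. 1 / ?c A) = (\<Sum>A\<in>F. 1 - m / ?c A)"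
    by (simp add: sum_subtractf sum_distrib_left)
  also have "\<dots> \<le> (\<Sum>A\<in>F \<inter> ?L. 1 - m / ?c A)"
  proof -
    have "(\<Sum>A\<in>F - ?L. 1 - m / ?c A) \<le> 0"
    proof (rule sum_nonpos)
      fix A assume A: "A \<in> F - ?L"
      then have "A \<subseteq> U" using assms(2) by blast
      then have "card A \<in> {..card U} - J" using A assms(1) by (auto intro: card_mono)
      then show "1 - m / ?c A \<le> 0" using small pos[OF \<open>A \<subseteq> U\<close>] by (simp add: field_simps)
    qed
    then show ?thesis using sum.Int_Diff[OF finF, of "\<lambda>A. 1 - m / ?c A" ?L] by linarith
  qed
  also have "\<dots> \<le> (\<Sum>A\<in>?L. 1 - m / ?c A)"
  proof (rule sum_mono2)
    fix A assume "A \<in> ?L - F \<inter> ?L"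
    then show "0 \<le> 1 - m / ?c A" using large pos[of A] by (simp add: field_simps)
  qed (use assms(1) in auto)
  also have "\<dots> = (\<Sum>i\<in>J. real (card U choose i) * (1 - m / real (card U choose i)))"
    by (rule sum_over_levels[OF assms(1) finJ])
  also have "\<dots> = (\<Sum>i\<in>J. real (card U choose i) - m)"
  proof (rule sum.cong[OF refl])
    fix i assume "i \<in> J"
    then have "card U choose i > 0" using assms(3) by auto
    then show "real (card U choose i) * (1 - m / real (card U choose i)) = real (card U choose i) - m"
      by (simp add: field_simps)
  qed
  also have "\<dots> = real (\<Sum>i\<in>J. card U choose i) - m * real (card J)"
    by (simp add: sum_subtractf)
  finally show ?thesis by (simp add: algebra_simps)
qed

text \<open>The threshold \<^term>\<open>m \<ge> 2\<close> pays for the case in which both \<open>{}\<close> and \<^term>\<open>U\<close> are members: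
removing the two lowers the LYM sum to at most \<^term>\<open>k - 1\<close>.\<close>

lemma card_Y_free_le:
  assumes "finite U" "F \<subseteq> Pow U" "k \<ge> 2" "\<not> contains_Y k F" "\<not> contains_Y' k F"
    and J: "J \<subseteq> {..card U}" "card J = k"
    and large: "\<And>i. i \<in> J \<Longrightarrow> m \<le> card U choose i"
    and small: "\<And>i. i \<in> {..card U} - J \<Longrightarrow> card U choose i \<le> m"
    and "m \<ge> 2"
  shows "card F \<le> (\<Sum>i\<in>J. card U choose i)"
proof -
  let ?P = "permutations_of_set U"
  let ?lym = "\<lambda>G. \<Sum>A\<in>G. 1 / real (card U choose card A)"
  have finF: "finite F" using assms finite_subset by blast
  define N where "N = (\<Sum>i\<in>J. card U choose i)"
  have bound: "real (card G) + real m * (real k - ?lym G) \<le> real N"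
    if "G \<subseteq> F" for G
    unfolding N_def
    using card_le_by_LYM_sum[of U G J "real m"] that assms by auto
  have total: "(\<Sum>xs\<in>?P. real (card (G \<inter> prefix_sets xs))) = fact (card U) * ?lym G"
    if "G \<subseteq> F" for G
    using sum_card_family_prefixes[of U G] that assms(1,2) by blast
  have ends: "{} \<in> prefix_sets xs" "U \<in> prefix_sets xs" if "xs \<in> ?P" for xs
    using prefix_sets_ends[of xs] permutations_of_setD(1)[OF that] by auto
  consider (none) "{} \<notin> F" "U \<notin> F" | (both) "{} \<in> F" "U \<in> F"
    | (one) E where "E \<in> F" "E = {} \<or> E = U" "{} \<notin> F \<or> U \<notin> F"
    by blast
  then have "card F \<le> N"
  proof cases
    case none
    then have "real m * (real k - ?lym F) \<ge> 0"
      using LYM_sum_le[OF assms(1-5)] by simp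
    with bound[of F] show ?thesis by simp
  next
    case both
    let ?G = "F - {{}, U}"
    have "U \<noteq> {}"
    proof
      assume "U = {}"
      then have "card J \<le> card {..0::nat}" using J(1) by (intro card_mono) auto
      with J(2) \<open>k \<ge> 2\<close> show False by simp
    qed
    have "card (?G \<inter> prefix_sets xs) \<le> k - 1" if "xs \<in> ?P" for xs
    proof -
      have "?G \<inter> prefix_sets xs = F \<inter> prefix_sets xs - {{}, U}" by auto
      then have "card (?G \<inter> prefix_sets xs) = card (F \<inter> prefix_sets xs) - 2"
        using both ends[OF that] \<open>U \<noteq> {}\<close> by (simp add: card_Diff_subset)
      then show ?thesis using card_family_prefixes_le[OF assms(4), of xs] by linarith
    qed
    then have "(\<Sum>xs\<in>?P. real (card (?G \<inter> prefix_sets xs))) \<le> real (card ?P) * real (k - 1)"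
      by (intro sum_bounded_above) simp
    then have "fact (card U) * ?lym ?G \<le> fact (card U) * real (k - 1)"
      using total[of ?G] assms(1) by auto
    then have "?lym ?G \<le> real (k - 1)" by simp
    then have "real k - ?lym ?G \<ge> 1" using \<open>k \<ge> 2\<close> by simp
    then have "real m * (real k - ?lym ?G) \<ge> 2 * 1"
      using \<open>m \<ge> 2\<close> by (intro mult_mono) auto
    moreover have "card ?G = card F - 2" "card F \<ge> 2"
      using both \<open>U \<noteq> {}\<close> finF card_mono[OF finF, of "{{}, U}"] by (auto simp: card_Diff_subset)
    ultimately show ?thesis using bound[of ?G] by auto
  next
    case one
    let ?G = "F - {E}"
    have drop: "card (?G \<inter> prefix_sets xs) = card (F \<inter> prefix_sets xs) - 1" if "xs \<in> ?P" for xs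
    proof -
      have "?G \<inter> prefix_sets xs = F \<inter> prefix_sets xs - {E}" by auto
      moreover have "E \<in> F \<inter> prefix_sets xs"
        using one(1) ends[OF that] disjE[OF one(2)] by blast
      ultimately show ?thesis by (simp add: card_Diff_singleton)
    qed
    obtain xs where xs: "xs \<in> ?P" "card (F \<inter> prefix_sets xs) \<le> k"
      using exists_permutation_not_long[OF assms(1-5) one(3)] by blast
    have "(\<Sum>xs\<in>?P. real (card (?G \<inter> prefix_sets xs))) < (\<Sum>xs\<in>?P. real k)"
    proof (rule sum_strict_mono_ex1)
      show "\<forall>xs\<in>?P. real (card (?G \<inter> prefix_sets xs)) \<le> real k"
      proof
        fix xs assume "xs \<in> ?P"
        then show "real (card (?G \<inter> prefix_sets xs)) \<le> real k"
          using drop[of xs] card_family_prefixes_le[OF assms(4), of xs] by simp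
      qed
      show "\<exists>xs\<in>?P. real (card (?G \<inter> prefix_sets xs)) < real k"
      proof (rule bexI[OF _ xs(1)])
        show "real (card (?G \<inter> prefix_sets xs)) < real k"
          using xs(2) drop[OF xs(1)] \<open>k \<ge> 2\<close> by linarith
      qed
    qed simp
    then have "fact (card U) * ?lym ?G < fact (card U) * real k"
      using total[of ?G] assms(1) by auto
    then have "real m * (real k - ?lym ?G) > 0" using \<open>m \<ge> 2\<close> by simp
    with bound[of ?G] have "card ?G < N" by auto
    moreover have "card ?G = card F - 1"
      using one(1) by (simp add: card_Diff_singleton)
    ultimately show ?thesis by linarith
  qed
  then show ?thesis by (simp add: N_def)
qed

text \<open>Sorting the indices by their binomial coefficients, instead of the coefficients themselves, yields
the set of the \<^term>\<open>k\<close> winning levels; ties are broken arbitrarily. The index \<open>i0\<close> marks the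
smallest coefficient selected.\<close>

lemma Sigma_largest_eq_sum:
  assumes "1 \<le> k" "k \<le> n + 1"
  obtains J i0 where "J \<subseteq> {..n}" "card J = k" "i0 \<in> J" "Sigma_largest n k = (\<Sum>i\<in>J. n choose i)"
    "\<And>i. i \<in> J \<Longrightarrow> n choose i0 \<le> n choose i"
    "\<And>i. i \<in> {..n} - J \<Longrightarrow> n choose i \<le> n choose i0"
proof -
  let ?f = "\<lambda>i. n choose i"
  define ys where "ys = sort_key ?f [0..<n + 1]"
  define xs where "xs = rev ys"
  have xs: "set xs = {..n}" "distinct xs" "length xs = n + 1"
    by (auto simp: xs_def ys_def)
  have "sort (map ?f [0..<n + 1]) = map ?f ys"
    by (rule properties_for_sort) (simp_all add: ys_def)
  then have sig: "Sigma_largest n k = sum_list (map ?f (take k xs))"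
    by (simp add: Sigma_largest_def xs_def rev_map take_map)
  have "sorted (map ?f ys)" by (simp add: ys_def)
  then have sw: "sorted_wrt (\<lambda>i j. ?f j \<le> ?f i) xs"
    by (simp add: xs_def sorted_wrt_rev sorted_map)
  have desc: "?f (xs ! b) \<le> ?f (xs ! a)" if "a \<le> b" "b < n + 1" for a b
    using sorted_wrt_nth_less[OF sw, of a b] that xs(3) by (cases "a = b") auto
  show ?thesis
  proof (rule that[of "set (take k xs)" "xs ! (k - 1)"])
    show "set (take k xs) \<subseteq> {..n}" using xs(1) set_take_subset by metis
    show "card (set (take k xs)) = k" using xs assms by (simp add: distinct_card)
    show "xs ! (k - 1) \<in> set (take k xs)"
      using xs(3) assms by (auto simp: in_set_conv_nth intro!: exI[of _ "k - 1"])
    show "Sigma_largest n k = sum ?f (set (take k xs))"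
      using sig xs(2) by (simp add: sum_list_distinct_conv_sum_set)
  next
    fix i assume "i \<in> set (take k xs)"
    then obtain a where "a < k" "i = xs ! a" using xs(3) by (auto simp: in_set_conv_nth)
    then show "?f (xs ! (k - 1)) \<le> ?f i" using desc[of a "k - 1"] assms by auto
  next
    fix i assume "i \<in> {..n} - set (take k xs)"
    then have "i \<in> set xs" "i \<notin> set (take k xs)" using xs(1) by auto
    then obtain b where "b < n + 1" "i = xs ! b" "\<not> b < k"
      using xs(3) by (auto simp: in_set_conv_nth)
    then show "?f i \<le> ?f (xs ! (k - 1))" using desc[of "k - 1" b] assms by auto
  qed
qed

text \<open>All \<^term>\<open>n - 1\<close> inner coefficients are at least two. If the smallest selected one were at most one,
then all inner levels would be selected and an outer one as well, which exceeds
\<^term>\<open>k \<le> n - 1\<close>.\<close>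

lemma large_binomial_threshold:
  assumes "k + 1 \<le> n" "k \<ge> 2" "J \<subseteq> {..n}" "card J = k" "i0 \<in> J"
    and small: "\<And>i. i \<in> {..n} - J \<Longrightarrow> n choose i \<le> n choose i0"
  shows "2 \<le> n choose i0"
proof (rule ccontr)
  assume "\<not> ?thesis"
  then have le1: "n choose i0 \<le> 1" by simp
  have inner: "n choose i \<ge> 2" if i: "i \<in> {1..n - 1}" for i
  proof -
    have "i < n" "i \<ge> 1" using i assms(1) by auto
    then have "n choose i = (n - 1 choose (i - 1)) + (n - 1 choose i)"
      using choose_reduce_nat[of n i] by simp
    moreover have "n - 1 choose (i - 1) > 0" "n - 1 choose i > 0"
      using \<open>i < n\<close> by auto
    ultimately show ?thesis by linarith
  qed
  have "{1..n - 1} \<subseteq> J"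
  proof
    fix i assume i: "i \<in> {1..n - 1}"
    show "i \<in> J"
    proof (rule ccontr)
      assume "i \<notin> J"
      moreover have "i \<le> n" using i by auto
      ultimately show False using small[of i] inner[OF i] le1 by simp
    qed
  qed
  moreover have "i0 \<notin> {1..n - 1}" using inner le1 by fastforce
  moreover have "finite J" using assms(3) finite_subset by blast
  ultimately have "card (insert i0 {1..n - 1}) \<le> card J"
    using assms(5) by (intro card_mono) auto
  with \<open>i0 \<notin> {1..n - 1}\<close> show False using assms(1,2,4) by simp
qed

section \<open>Full levels contain neither poset\<close>

text \<open>An embedding sends a chain to comparable, pairwise distinct sets, which lie on different levels.\<close>

lemma weak_subposet_levels_chain_bound:
  assumes "weak_subposet P (inclusion_poset {A. A \<subseteq> U \<and> card A \<in> J})" "finite U" "finite J"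
    and "C \<subseteq> fst P" "\<And>x y. x \<in> C \<Longrightarrow> y \<in> C \<Longrightarrow> (x, y) \<in> snd P \<or> (y, x) \<in> snd P"
  shows "card C \<le> card J"
proof -
  obtain \<phi> where \<phi>: "inj_on \<phi> (fst P)" "\<phi> ` fst P \<subseteq> {A. A \<subseteq> U \<and> card A \<in> J}"
    "\<And>x y. x \<in> fst P \<Longrightarrow> y \<in> fst P \<Longrightarrow> (x, y) \<in> snd P \<Longrightarrow> \<phi> x \<subseteq> \<phi> y"
    using assms(1) unfolding weak_subposet_def inclusion_poset_def by auto
  have "inj_on (\<lambda>x. card (\<phi> x)) C"
  proof (rule inj_onI)
    fix x y assume xy: "x \<in> C" "y \<in> C" "card (\<phi> x) = card (\<phi> y)"
    then have P: "x \<in> fst P" "y \<in> fst P" using assms(4) by auto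
    then have "\<phi> x \<subseteq> U" "\<phi> y \<subseteq> U" using \<phi>(2) by auto
    then have "finite (\<phi> x)" "finite (\<phi> y)" using assms(2) finite_subset by blast+
    moreover have "\<phi> x \<subseteq> \<phi> y \<or> \<phi> y \<subseteq> \<phi> x"
      using assms(5)[OF xy(1,2)] \<phi>(3) P by blast
    ultimately have "\<phi> x = \<phi> y" using xy(3) by (metis card_subset_eq)
    then show "x = y" using \<phi>(1) P by (simp add: inj_on_eq_iff)
  qed
  moreover have "(\<lambda>x. card (\<phi> x)) ` C \<subseteq> J" using \<phi>(2) assms(4) by auto
  ultimately show ?thesis using assms(3) by (rule card_inj_on_le)
qed

lemma Y_gen_rtrancl:
  assumes "1 \<le> i" "i \<le> j" "j \<le> k"
  shows "(X i, X j) \<in> (Y_gen k)\<^sup>*"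
  using assms(2,3)
proof (induction j rule: dec_induct)
  case (step j)
  then have "(X j, X (Suc j)) \<in> Y_gen k" using assms(1) by (auto simp: Y_gen_def)
  with step show ?case by (simp add: rtrancl.rtrancl_into_rtrancl)
qed simp

lemma Y_poset_chain:
  assumes "k \<ge> 1" and x: "x \<in> X ` {1..k} \<union> {Y}" and y: "y \<in> X ` {1..k} \<union> {Y}"
  shows "(x, y) \<in> snd (Y_poset k) \<or> (y, x) \<in> snd (Y_poset k)"
proof -
  have "(X k, Y) \<in> Y_gen k" by (simp add: Y_gen_def)
  then have top: "(X i, Y) \<in> (Y_gen k)\<^sup>*" if "1 \<le> i" "i \<le> k" for i
    using Y_gen_rtrancl[OF that, of k] by (simp add: rtrancl.rtrancl_into_rtrancl)
  have "(x, y) \<in> (Y_gen k)\<^sup>* \<or> (y, x) \<in> (Y_gen k)\<^sup>*"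
    using x y top Y_gen_rtrancl[of _ _ k] by (auto, metis nat_le_linear)
  moreover have "x \<in> Y_carrier k" "y \<in> Y_carrier k"
    using x y by (auto simp: Y_carrier_def)
  ultimately show ?thesis by (simp add: Y_poset_def)
qed

lemma levels_Y_free:
  assumes "finite U" "finite J" "card J = k" "k \<ge> 1"
  shows "\<not> weak_subposet (Y_poset k) (inclusion_poset {A. A \<subseteq> U \<and> card A \<in> J})"
    and "\<not> weak_subposet (Y_poset' k) (inclusion_poset {A. A \<subseteq> U \<and> card A \<in> J})"
proof -
  let ?C = "X ` {1..k} \<union> {Y}"
  have "card ?C = k + 1"
    by (subst card_Un_disjoint) (auto simp: card_image inj_on_def)
  moreover have "?C \<subseteq> fst (Y_poset k)" "?C \<subseteq> fst (Y_poset' k)"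
    by (auto simp: Y_poset_def Y_poset'_def dual_poset_def Y_carrier_def)
  moreover have "(x, y) \<in> snd (Y_poset' k) \<or> (y, x) \<in> snd (Y_poset' k)"
    if "x \<in> ?C" "y \<in> ?C" for x y
    using Y_poset_chain[OF assms(4) that] by (auto simp: Y_poset'_def dual_poset_def)
  ultimately have "\<not> weak_subposet P (inclusion_poset {A. A \<subseteq> U \<and> card A \<in> J})"
    if "P = Y_poset k \<or> P = Y_poset' k" for P
    using weak_subposet_levels_chain_bound[OF _ assms(1,2), of P ?C]
      Y_poset_chain[OF assms(4)] assms(3) that by fastforce
  then show "\<not> weak_subposet (Y_poset k) (inclusion_poset {A. A \<subseteq> U \<and> card A \<in> J})"
    "\<not> weak_subposet (Y_poset' k) (inclusion_poset {A. A \<subseteq> U \<and> card A \<in> J})"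
    by simp_all
qed

section \<open>The extremal number\<close>

theorem theorem4:
  fixes k n :: nat
  assumes "k \<ge> 2" and "n \<ge> k + 1"
  shows "La n (Y_poset k) (Y_poset' k) = Sigma_largest n k"
proof -
  let ?U = "{1..n}"
  obtain J i0 where J: "J \<subseteq> {..n}" "card J = k" "i0 \<in> J" "Sigma_largest n k = (\<Sum>i\<in>J. n choose i)"
    and large: "\<And>i. i \<in> J \<Longrightarrow> n choose i0 \<le> n choose i"
    and small: "\<And>i. i \<in> {..n} - J \<Longrightarrow> n choose i \<le> n choose i0"
    using Sigma_largest_eq_sum[of k n] assms by auto
  have finJ: "finite J" using J(1) finite_subset by blast
  have two: "2 \<le> n choose i0"
    using large_binomial_threshold[OF assms(2,1) J(1-3) small] .
  let ?S = "{card \<A> | \<A>. \<A> \<subseteq> Pow ?U \<and> \<not> weak_subposet (Y_poset k) (inclusion_poset \<A>)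
    \<and> \<not> weak_subposet (Y_poset' k) (inclusion_poset \<A>)}"
  have "Max ?S = Sigma_largest n k"
  proof (rule Max_eqI)
    have "?S \<subseteq> card ` Pow (Pow ?U)" by auto
    then show "finite ?S" by (rule finite_subset) simp
  next
    fix c assume "c \<in> ?S"
    then obtain F where F: "c = card F" "F \<subseteq> Pow ?U"
      "\<not> weak_subposet (Y_poset k) (inclusion_poset F)"
      "\<not> weak_subposet (Y_poset' k) (inclusion_poset F)"
      by auto
    have fin: "\<And>A. A \<in> F \<Longrightarrow> finite A" using F(2) finite_subset[of _ ?U] by auto
    have "\<not> contains_Y k F" "\<not> contains_Y' k F"
      using F(3,4) contains_Y_imp_weak_subposet[OF _ _ fin] contains_Y'_imp_weak_subposet[OF _ _ fin]
        assms(1) by auto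
    then show "c \<le> Sigma_largest n k"
      using card_Y_free_le[of ?U F k J "n choose i0"] F(1,2) assms(1) J large small two by simp
  next
    let ?L = "{A. A \<subseteq> ?U \<and> card A \<in> J}"
    have "card ?L = Sigma_largest n k"
      using sum_over_levels[of ?U J "\<lambda>_. 1 :: nat"] finJ J(4) by simp
    moreover have "\<not> weak_subposet (Y_poset k) (inclusion_poset ?L)"
      "\<not> weak_subposet (Y_poset' k) (inclusion_poset ?L)"
      using levels_Y_free[of ?U J k] finJ J(2) assms(1) by auto
    ultimately show "Sigma_largest n k \<in> ?S" by (intro CollectI exI[of _ ?L]) auto
  qed
  then show ?thesis unfolding La_def .
qed

end
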